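(* Let $A\in\mathbb{R}^{m\times n}$, $1\le k<\min(m,n)$, and let $\widehat V_k\in\mathbb{R}^{m\times k}$, $\widehat S_k\in\mathbb{R}^{k\times k}$, $\widehat W_k\in\mathbb{R}^{n\times k}$ satisfy $$\|A-\widehat V_k\widehat S_k\widehat W_k^T\|\le \theta\,\sigma_{k+1}+\phi$$ for some real quantities $\theta,\phi$, with $\widehat V_k$ and $\widehat W_k$ of full column rank. Let $p=\mathrm{DEIM}(\widehat V_k)$ and $q=\mathrm{DEIM}(\widehat W_k)$ be the index vectors produced by the DEIM point selection algorithm executed in exact arithmetic, and let $P=I(:,p)\in\mathbb{R}^{m\times k}$, $Q=I(:,q)\in\mathbb{R}^{n\times k}$. Then $\tilde\eta_p=\|(P^T\widehat V_k)^{-1}\|$ and $\tilde\eta_q=\|(\widehat W_k^TQ)^{-1}\|$ satisfy $$\tilde\eta_p\le \sqrt{\frac{mk}{3}}\;\frac{2^k}{\sigma_{\min}(\widehat V_k)},\qquad \tilde\eta_q\le \sqrt{\frac{nk}{3}}\;\frac{2^k}{\sigma_{\min}(\widehat W_k)}.$$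
   Context: $\|\cdot\|$ denotes the matrix 2-norm (spectral norm). $\sigma_{k+1}$ is the $(k+1)$-th singular value of $A$ in descending order, and $\sigma_{\min}(X)$ is the smallest (i.e. $k$-th) singular value of a matrix $X$ with $k$ columns and at least $k$ rows. The columns of $\widehat V_k$ and $\widehat W_k$ are not assumed orthonormal. $I(:,p)$ (resp. $I(:,q)$) is the matrix whose $j$-th column is the $p_j$-th (resp. $q_j$-th) column of the identity matrix of size $m$ (resp. $n$). DEIM point selection: given a matrix $V=[v_1,\dots,v_k]\in\mathbb{R}^{m\times k}$ with $m\ge k$, $\mathrm{DEIM}(V)$ returns $p=(p_1,\dots,p_k)$ defined as follows. $p_1$ is an index at which $|v_1|$ attains its maximal entry. For $j=2,\dots,k$, with $\mathbf p=(p_1,\dots,p_{j-1})$, let $c=V(\mathbf p,1\!:\!j-1)^{-1}v_j(\mathbf p)$ and $r=v_j-V(:,1\!:\!j-1)c$, and let $p_j$ be an index at which $|r|$ attains its maximal entry. Here $V(\mathbf p,1\!:\!j-1)$ is the submatrix with rows $\mathbf p$ and the first $j-1$ columns, $v_j(\mathbf p)$ the subvector with entries $\mathbf p$, and absolute values of vectors are entrywise. *)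

theory Defs
  imports
    "Jordan_Normal_Form.Char_Poly"
    "Jordan_Normal_Form.DL_Rank"
    "Jordan_Normal_Form.Gauss_Jordan_Elimination"
    "HOL-Analysis.L2_Norm"
begin

text \<open>All indices are 0-based, as usual for \<^typ>\<open>'a vec\<close>, \<^typ>\<open>'a mat\<close> and lists;
  only the index of \<open>singular_value\<close> is 1-based, as in the mathematical notation.\<close>

definition vec_norm2 :: "real vec \<Rightarrow> real" where
  "vec_norm2 v = L2_set (\<lambda>i. v $ i) {0..<dim_vec v}"

text \<open>The operator norm induced by the Euclidean norm. The zero vector contributes the value
  \<open>0 / 0 = 0\<close>, so the supremum is never taken over the empty set.\<close>

definition spectral_norm :: "real mat \<Rightarrow> real" where
  "spectral_norm A = (SUP x\<in>carrier_vec (dim_col A). vec_norm2 (A *\<^sub>v x) / vec_norm2 x)"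

text \<open>An \<open>m \<times> n\<close> matrix has \<open>min m n\<close> singular values; for \<open>n > m\<close> the spectrum of
  \<open>A\<^sup>T A\<close> contains \<open>n - m\<close> further zeros, which are dropped.
  \<^const>\<open>proots\<close> counts the real roots with multiplicity.\<close>

definition singular_values :: "real mat \<Rightarrow> real list" where
  "singular_values A = take (min (dim_row A) (dim_col A))
     (rev (sorted_list_of_multiset (image_mset sqrt (proots (char_poly (A\<^sup>T * A))))))"

text \<open>Since \<open>A\<^sup>T A\<close> is symmetric, its characteristic polynomial splits over the reals, so
  no eigenvalue is lost: \<^const>\<open>singular_values\<close> always has the full length.\<close>

lemma gram_complex_eigenvalue_real:
  fixes A :: "real mat"
  assumes ev: "eigenvalue (map_mat complex_of_real (A\<^sup>T * A)) a"
  shows "a \<in> \<real>"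
proof -
  define m n where "m = dim_row A" and "n = dim_col A"
  define C where "C = map_mat complex_of_real (A\<^sup>T * A)"
  have A: "A \<in> carrier_mat m n" unfolding m_def n_def by (intro carrier_matI) simp_all
  have C: "C \<in> carrier_mat n n" unfolding C_def n_def by (intro carrier_matI) simp_all
  have "(A\<^sup>T * A)\<^sup>T = A\<^sup>T * A"
    using transpose_mult[of "A\<^sup>T" n m A n] A by simp
  then have CT: "C\<^sup>T = C" unfolding C_def by (simp add: map_mat_transpose)
  obtain v where v: "v \<in> carrier_vec n" "v \<noteq> 0\<^sub>v n" and Cv: "C *\<^sub>v v = a \<cdot>\<^sub>v v"
    using ev C unfolding eigenvalue_def eigenvector_def C_def[symmetric] by auto
  define w where "w = conjugate v"
  have w: "w \<in> carrier_vec n" using v by (simp add: w_def)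
  have "C *\<^sub>v w = conjugate (C *\<^sub>v v)"
    unfolding w_def using v C
    by (intro eq_vecI) (auto simp: C_def n_def scalar_prod_def)
  also have "\<dots> = cnj a \<cdot>\<^sub>v w"
    unfolding Cv w_def using v by (intro eq_vecI) auto
  finally have Cw: "C *\<^sub>v w = cnj a \<cdot>\<^sub>v w" .
  have "(C *\<^sub>v v) \<bullet> w = v \<bullet> (C *\<^sub>v w)"
    using transpose_vec_mult_scalar[OF C w v(1)] CT w v C
    by (metis comm_scalar_prod mult_mat_vec_carrier)
  then have "a * (v \<bullet> w) = cnj a * (v \<bullet> w)"
    using v w by (simp add: Cv Cw)
  moreover have "v \<bullet> w \<noteq> 0"
    using v by (simp add: w_def)
  ultimately have "cnj a = a" by simp
  then show ?thesis by (simp add: Reals_cnj_iff)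
qed

lemma length_singular_values: "length (singular_values A) = min (dim_row A) (dim_col A)"
proof -
  define n where "n = dim_col A"
  define B where "B = A\<^sup>T * A"
  have B: "B \<in> carrier_mat n n" unfolding B_def n_def by (intro carrier_matI) simp_all
  define C where "C = map_mat complex_of_real B"
  have C: "C \<in> carrier_mat n n" using B by (simp add: C_def)
  obtain as where as: "char_poly C = (\<Prod>a\<leftarrow>as. [:- a, 1:])" "length as = n"
    using char_poly_factorized[OF C] by blast
  have re: "complex_of_real (Re a) = a" if "a \<in> set as" for a
  proof -
    have "poly (char_poly C) a = 0"
      using that unfolding as(1) poly_prod_list by (force simp: prod_list_zero_iff)
    then have "eigenvalue C a" using eigenvalue_root_char_poly[OF C] by blast
    then show ?thesis
      using gram_complex_eigenvalue_real unfolding C_def B_def by (simp add: of_real_Re)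
  qed
  interpret h: map_poly_inj_idom_hom complex_of_real ..
  have "map_poly complex_of_real (char_poly B) = char_poly C"
    unfolding C_def by (rule of_real_hom.char_poly_hom[OF B, symmetric])
  also have "\<dots> = map_poly complex_of_real (\<Prod>a\<leftarrow>as. [:- Re a, 1:])"
    unfolding as(1) h.hom_prod_list map_map comp_def
    by (rule arg_cong[where f = prod_list], rule map_cong) (auto simp: re)
  finally have "char_poly B = (\<Prod>a\<leftarrow>as. [:- Re a, 1:])"
    by (rule h.injectivity)
  moreover have "size (proots (\<Prod>a\<leftarrow>as. [:- Re a, 1:])) = length as"
    proof (induction as)
    case (Cons a as)
    have "[:- Re a, 1:] \<noteq> 0" and "(\<Prod>a\<leftarrow>as. [:- Re a, 1:]) \<noteq> 0"
      by (auto simp: prod_list_zero_iff)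
    from proots_mult[OF this] show ?case using Cons.IH
      by (simp only: list.map prod_list.Cons size_union proots_linear_factor list.size size_single)
  qed simp
  ultimately have "size (proots (char_poly B)) = n" using as(2) by simp
  moreover have "length (sorted_list_of_multiset M) = size M" for M :: "real multiset"
    by (metis mset_sorted_list_of_multiset size_mset)
  ultimately show ?thesis
    unfolding singular_values_def B_def[symmetric] by (simp add: n_def)
qed

definition singular_value :: "real mat \<Rightarrow> nat \<Rightarrow> real" where
  "singular_value A i = singular_values A ! (i - 1)"

definition sigma_min :: "real mat \<Rightarrow> real" where
  "sigma_min X = Min (set (singular_values X))"

definition selection_mat :: "nat \<Rightarrow> nat list \<Rightarrow> real mat" where
  "selection_mat m p = mat_of_cols m (map (col (1\<^sub>m m)) p)"

definition max_abs_index :: "real vec \<Rightarrow> nat \<Rightarrow> bool" where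
  "max_abs_index r i \<longleftrightarrow> i < dim_vec r \<and> (\<forall>i'<dim_vec r. \<bar>r $ i'\<bar> \<le> \<bar>r $ i\<bar>)"

text \<open>The vector whose largest entry determines the next index, when \<open>ps\<close> are the indices
  selected so far: \<open>v - V' c\<close> with \<open>v\<close> the column at position \<open>length ps\<close>, \<open>V'\<close> the columns
  before it, and \<open>c = V'(ps,:)\<^sup>-\<^sup>1 v(ps)\<close>.\<close>

definition deim_residual :: "real mat \<Rightarrow> nat list \<Rightarrow> real vec" where
  "deim_residual V ps = (let j = length ps in
     if j = 0 then col V 0
     else let c = the (mat_inverse (mat j j (\<lambda>(a, b). V $$ (ps ! a, b))))
                    *\<^sub>v vec j (\<lambda>a. V $$ (ps ! a, j))
       in col V j - mat (dim_row V) j (\<lambda>(a, b). V $$ (a, b)) *\<^sub>v c)"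

text \<open>A relation rather than a function: the index of a maximal entry need not be unique,
  and every way of resolving ties is admitted.\<close>

definition is_DEIM :: "real mat \<Rightarrow> nat list \<Rightarrow> bool" where
  "is_DEIM V p \<longleftrightarrow> length p = dim_col V \<and>
     (\<forall>j<dim_col V. max_abs_index (deim_residual V (take j p)) (p ! j))"

end

theory Submission
  imports Defs
begin

text \<open>
  Let \<open>V\<close> have full column rank \<open>k\<close> and let \<open>p\<close> be its DEIM indices. Both norms in question are norms
  of an inverse, so they are bounded by \<open>C\<close> as soon as the inverted matrix shrinks no vector by more
  than the factor \<open>C\<close>. For \<open>B = P\<^sup>T V\<close>, the submatrix of \<open>V\<close> with rows \<open>p\<close>, the proof therefore
  compares \<open>V x\<close> with \<open>B x\<close> from above and with \<open>x\<close> from below.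

  The \<open>j\<close>-th residual \<open>r\<^sub>j\<close> is the \<open>j\<close>-th column of \<open>V\<close> minus a combination of the preceding columns,
  so \<open>V x = \<Sum>\<^sub>j w\<^sub>j r\<^sub>j\<close> for suitable \<open>w\<close> (\<open>residual_combination\<close>). It vanishes at the indices chosen
  before \<open>p\<^sub>j\<close> and has its largest entry at \<open>p\<^sub>j\<close>. Thus the rows \<open>p\<close> of the residuals form a lower
  triangular matrix whose diagonal dominates its columns. Put \<open>z\<^sub>j = \<bar>w\<^sub>j r\<^sub>j(p\<^sub>j)\<bar>\<close>. Forward substitution
  gives \<open>z\<^sub>i \<le> \<bar>(B x)\<^sub>i\<bar> + \<Sum>\<^bsub>j<i\<^esub> z\<^sub>j\<close>, which entails \<open>\<parallel>z\<parallel>\<^sup>2 \<le> (4\<^sup>k / 3) \<parallel>B x\<parallel>\<^sup>2\<close>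
  (\<open>sum_squares_growth\<close>); and every entry of \<open>V x\<close> is at most \<open>\<Sum>\<^sub>j z\<^sub>j\<close> in absolute value, so
  \<open>\<parallel>V x\<parallel>\<^sup>2 \<le> m k \<parallel>z\<parallel>\<^sup>2\<close> (\<open>deim_selected_rows_bound\<close>). Together with \<open>\<sigma>\<^sub>m\<^sub>i\<^sub>n(V) \<parallel>x\<parallel> \<le> \<parallel>V x\<parallel>\<close>
  (\<open>sigma_min_lower_bound\<close>) this is the bound on \<open>B\<^sup>-\<^sup>1\<close>.

  That the residuals are determined, and that no pivot vanishes, is an induction on the number of
  selected indices which uses the independence of the columns (\<open>deim_leading_block_injective\<close>).
  The matrix \<open>W\<^sup>T Q\<close> is the transpose of \<open>Q\<^sup>T W\<close>, and the inverse of the transpose obeys the same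
  norm bound.
\<close>

section \<open>Euclidean norms of vectors and of inverse matrices\<close>

lemma vec_norm2_nonneg [simp]: "0 \<le> vec_norm2 v"
  by (simp add: vec_norm2_def L2_set_nonneg)

lemma vec_norm2_sq: "(vec_norm2 v)\<^sup>2 = v \<bullet> v"
  by (simp add: vec_norm2_def L2_set_def scalar_prod_def sum_nonneg power2_eq_square)

lemma vec_norm2_zero [simp]: "vec_norm2 (0\<^sub>v n) = 0"
  by (simp add: vec_norm2_def L2_set_def)

lemma vec_norm2_eq_0_iff:
  assumes "v \<in> carrier_vec n"
  shows "vec_norm2 v = 0 \<longleftrightarrow> v = 0\<^sub>v n"
proof
  assume "vec_norm2 v = 0"
  with assms show "v = 0\<^sub>v n"
    by (intro eq_vecI) (auto simp: vec_norm2_def L2_set_eq_0_iff)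
qed simp

lemma scalar_prod_le_vec_norm2:
  assumes "v \<in> carrier_vec n" "w \<in> carrier_vec n"
  shows "v \<bullet> w \<le> vec_norm2 v * vec_norm2 w"
proof -
  have "v \<bullet> w \<le> (\<Sum>i\<in>{0..<n}. \<bar>v $ i\<bar> * \<bar>w $ i\<bar>)"
    using assms unfolding scalar_prod_def
    by (auto intro!: sum_mono simp flip: abs_mult)
  also have "\<dots> \<le> vec_norm2 v * vec_norm2 w"
    using assms L2_set_mult_ineq[of "\<lambda>i. v $ i" "\<lambda>i. w $ i" "{0..<n}"]
    by (simp add: vec_norm2_def)
  finally show ?thesis .
qed

text \<open>The assumption \<open>0 \<le> C\<close> takes care of the zero vector, whose quotient is \<open>0 / 0 = 0\<close>.\<close>

lemma spectral_norm_le: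
  assumes N: "N \<in> carrier_mat l n" and C: "0 \<le> C"
    and le: "\<And>y. y \<in> carrier_vec n \<Longrightarrow> vec_norm2 (N *\<^sub>v y) \<le> C * vec_norm2 y"
  shows "spectral_norm N \<le> C"
  unfolding spectral_norm_def
proof (rule cSUP_least)
  show "(carrier_vec (dim_col N) :: real vec set) \<noteq> {}"
    using zero_carrier_vec by blast
  fix y :: "real vec" assume "y \<in> carrier_vec (dim_col N)"
  then have y: "y \<in> carrier_vec n" using N by simp
  show "vec_norm2 (N *\<^sub>v y) / vec_norm2 y \<le> C"
  proof (cases "vec_norm2 y = 0")
    case True
    then show ?thesis using C by simp
  next
    case False
    then have "0 < vec_norm2 y" by (simp add: order_less_le)
    then show ?thesis using le[OF y] by (simp add: divide_le_eq)
  qed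
qed

lemma mat_inverse_of_injective:
  fixes B :: "real mat"
  assumes B: "B \<in> carrier_mat k k"
    and inj: "\<And>x. x \<in> carrier_vec k \<Longrightarrow> B *\<^sub>v x = 0\<^sub>v k \<Longrightarrow> x = 0\<^sub>v k"
  shows "the (mat_inverse B) \<in> carrier_mat k k"
    and "B * the (mat_inverse B) = 1\<^sub>m k" and "the (mat_inverse B) * B = 1\<^sub>m k"
proof -
  have "det B \<noteq> 0"
    using det_0_iff_vec_prod_zero_field[OF B] inj by blast
  then have "B \<in> Units (ring_mat TYPE(real) k ())"
    by (rule det_non_zero_imp_unit[OF B])
  then obtain N where "mat_inverse B = Some N"
    using mat_inverse(1)[OF B, of "()"] by (cases "mat_inverse B") auto
  with mat_inverse(2)[OF B] show "the (mat_inverse B) \<in> carrier_mat k k"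
    "B * the (mat_inverse B) = 1\<^sub>m k" "the (mat_inverse B) * B = 1\<^sub>m k" by simp_all
qed

lemma invertible_matI_square:
  assumes "B \<in> carrier_mat k k" "N \<in> carrier_mat k k" "B * N = 1\<^sub>m k" "N * B = 1\<^sub>m k"
  shows "invertible_mat B"
  using assms unfolding invertible_mat_def inverts_mat_def by auto

text \<open>The bound passes to the transpose by duality. If \<open>M\<close> and \<open>N\<close> invert \<open>B\<^sup>T\<close> and \<open>B\<close>, and
  \<open>w = M y\<close>, then \<open>\<parallel>w\<parallel>\<^sup>2 = w \<bullet> B N w = (B\<^sup>T w) \<bullet> N w = y \<bullet> N w \<le> C \<parallel>y\<parallel> \<parallel>w\<parallel>\<close>.\<close>

lemma invertible_if_bounded_below:
  assumes B: "B \<in> carrier_mat k k" and C: "0 \<le> C"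
    and below: "\<And>x. x \<in> carrier_vec k \<Longrightarrow> vec_norm2 x \<le> C * vec_norm2 (B *\<^sub>v x)"
  shows "invertible_mat B" and "spectral_norm (the (mat_inverse B)) \<le> C"
    and "invertible_mat (B\<^sup>T)" and "spectral_norm (the (mat_inverse (B\<^sup>T))) \<le> C"
proof -
  have inj: "x = 0\<^sub>v k" if "x \<in> carrier_vec k" "B *\<^sub>v x = 0\<^sub>v k" for x
    using below[OF that(1)] that vec_norm2_eq_0_iff[OF that(1)] vec_norm2_nonneg[of x]
    by (simp del: vec_norm2_nonneg)
  define N where "N = the (mat_inverse B)"
  note N = mat_inverse_of_injective[OF B inj, folded N_def]
  show "invertible_mat B" using invertible_matI_square[OF B N(1,2,3)] .
  have N_le: "vec_norm2 (N *\<^sub>v y) \<le> C * vec_norm2 y" if y: "y \<in> carrier_vec k" for y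
  proof -
    have "B *\<^sub>v (N *\<^sub>v y) = y"
      using assoc_mult_mat_vec[OF B N(1) y] N(2) y by simp
    with below[of "N *\<^sub>v y"] N(1) y show ?thesis by simp
  qed
  show "spectral_norm (the (mat_inverse B)) \<le> C"
    unfolding N_def[symmetric] by (rule spectral_norm_le[OF N(1) C N_le])
  have BT: "B\<^sup>T \<in> carrier_mat k k" using B by simp
  have injT: "x = 0\<^sub>v k" if x: "x \<in> carrier_vec k" and 0: "B\<^sup>T *\<^sub>v x = 0\<^sub>v k" for x
  proof -
    have "x \<bullet> x = x \<bullet> (B *\<^sub>v (N *\<^sub>v x))"
      using assoc_mult_mat_vec[OF B N(1) x] N(2) x by simp
    also have "\<dots> = (B\<^sup>T *\<^sub>v x) \<bullet> (N *\<^sub>v x)"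
      using transpose_vec_mult_scalar[OF B _ x, of "N *\<^sub>v x"] N(1) x by simp
    also have "\<dots> = 0" using 0 N(1) x by simp
    finally show ?thesis using vec_norm2_sq[of x] vec_norm2_eq_0_iff[OF x] by simp
  qed
  define M where "M = the (mat_inverse (B\<^sup>T))"
  note M = mat_inverse_of_injective[OF BT injT, folded M_def]
  show "invertible_mat (B\<^sup>T)" using invertible_matI_square[OF BT M(1,2,3)] .
  have M_le: "vec_norm2 (M *\<^sub>v y) \<le> C * vec_norm2 y" if y: "y \<in> carrier_vec k" for y
  proof -
    define w where "w = M *\<^sub>v y"
    have w: "w \<in> carrier_vec k" using M(1) y by (simp add: w_def)
    have Nw: "N *\<^sub>v w \<in> carrier_vec k" using N(1) w by simp
    have "(vec_norm2 w)\<^sup>2 = w \<bullet> (B *\<^sub>v (N *\<^sub>v w))"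
      using assoc_mult_mat_vec[OF B N(1) w] N(2) w by (simp add: vec_norm2_sq)
    also have "\<dots> = (B\<^sup>T *\<^sub>v w) \<bullet> (N *\<^sub>v w)"
      using transpose_vec_mult_scalar[OF B Nw w] by simp
    also have "B\<^sup>T *\<^sub>v w = y"
      using assoc_mult_mat_vec[OF BT M(1) y] M(2) y by (simp add: w_def)
    also have "y \<bullet> (N *\<^sub>v w) \<le> vec_norm2 y * vec_norm2 (N *\<^sub>v w)"
      by (rule scalar_prod_le_vec_norm2[OF y Nw])
    also have "\<dots> \<le> vec_norm2 y * (C * vec_norm2 w)"
      by (intro mult_left_mono N_le w) simp
    finally have "vec_norm2 w * vec_norm2 w \<le> (C * vec_norm2 y) * vec_norm2 w"
      by (simp add: power2_eq_square mult_ac)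
    then show ?thesis
      using C unfolding w_def[symmetric]
      by (cases "vec_norm2 w = 0") (auto simp: order_less_le)
  qed
  show "spectral_norm (the (mat_inverse (B\<^sup>T))) \<le> C"
    unfolding M_def[symmetric] by (rule spectral_norm_le[OF M(1) C M_le])
qed

section \<open>The smallest singular value as a lower bound\<close>

text \<open>Applied to the inverse of a semidefinite matrix, where any finite constant serves the purpose.\<close>

lemma quadratic_form_bounded:
  fixes N :: "real mat"
  assumes N: "N \<in> carrier_mat n n"
  obtains K where "0 < K" "\<And>x. x \<in> carrier_vec n \<Longrightarrow> x \<bullet> (N *\<^sub>v x) \<le> K * (x \<bullet> x)"
proof
  let ?K = "1 + (\<Sum>i<n. \<Sum>j<n. \<bar>N $$ (i,j)\<bar>)"
  show "0 < ?K" by (simp add: add_pos_nonneg sum_nonneg)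
  fix x :: "real vec" assume x: "x \<in> carrier_vec n"
  have xx: "x \<bullet> x = (\<Sum>i<n. (x $ i)\<^sup>2)"
    using x by (simp add: scalar_prod_def atLeast0LessThan power2_eq_square)
  have prod: "\<bar>x $ i * x $ j\<bar> \<le> x \<bullet> x" if "i < n" "j < n" for i j
  proof -
    have "(x $ i)\<^sup>2 \<le> x \<bullet> x" "(x $ j)\<^sup>2 \<le> x \<bullet> x"
      unfolding xx using that by (auto intro!: member_le_sum)
    moreover have "2 * \<bar>x $ i * x $ j\<bar> \<le> (x $ i)\<^sup>2 + (x $ j)\<^sup>2"
      using sum_squares_bound[of "\<bar>x $ i\<bar>" "\<bar>x $ j\<bar>"] by (simp add: abs_mult)
    ultimately show ?thesis by linarith
  qed
  have "x \<bullet> (N *\<^sub>v x) = (\<Sum>i<n. \<Sum>j<n. N $$ (i,j) * (x $ i * x $ j))"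
    using N x by (simp add: scalar_prod_def atLeast0LessThan sum_distrib_left mult_ac)
  also have "\<dots> \<le> (\<Sum>i<n. \<Sum>j<n. \<bar>N $$ (i,j)\<bar> * (x \<bullet> x))"
  proof (intro sum_mono)
    fix i j assume "i \<in> {..<n}" "j \<in> {..<n}"
    then have "\<bar>N $$ (i,j) * (x $ i * x $ j)\<bar> \<le> \<bar>N $$ (i,j)\<bar> * (x \<bullet> x)"
      using prod[of i j] by (subst abs_mult) (intro mult_left_mono, auto)
    then show "N $$ (i,j) * (x $ i * x $ j) \<le> \<bar>N $$ (i,j)\<bar> * (x \<bullet> x)" by linarith
  qed
  also have "\<dots> = (\<Sum>i<n. \<Sum>j<n. \<bar>N $$ (i,j)\<bar>) * (x \<bullet> x)"
    by (simp add: sum_distrib_right)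
  also have "\<dots> \<le> ?K * (x \<bullet> x)"
    by (intro mult_right_mono) (auto simp: xx sum_nonneg)
  finally show "x \<bullet> (N *\<^sub>v x) \<le> ?K * (x \<bullet> x)" .
qed

lemma symmetric_mat_scalar_prod:
  fixes H :: "real mat"
  assumes H: "H \<in> carrier_mat n n" "H\<^sup>T = H" and x: "x \<in> carrier_vec n" and y: "y \<in> carrier_vec n"
  shows "y \<bullet> (H *\<^sub>v x) = x \<bullet> (H *\<^sub>v y)"
  using transpose_vec_mult_scalar[OF H(1) x y] H x y
  by (metis comm_scalar_prod mult_mat_vec_carrier)

text \<open>The quadratic form of \<open>H\<close> at \<open>s x + t y\<close> is nonnegative for all \<open>s\<close> and \<open>t\<close>, so its discriminant
  is not positive. Semidefiniteness is all that is known of \<open>H\<close>, so \<open>a\<close> may vanish; then the form is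
  linear in \<open>s\<close> and \<open>b\<close> must vanish too.\<close>

lemma psd_Cauchy_Schwarz:
  fixes H :: "real mat"
  assumes H: "H \<in> carrier_mat n n" and sym: "H\<^sup>T = H"
    and psd: "\<And>x. x \<in> carrier_vec n \<Longrightarrow> 0 \<le> x \<bullet> (H *\<^sub>v x)"
    and x: "x \<in> carrier_vec n" and y: "y \<in> carrier_vec n"
  shows "(x \<bullet> (H *\<^sub>v y))\<^sup>2 \<le> (x \<bullet> (H *\<^sub>v x)) * (y \<bullet> (H *\<^sub>v y))"
proof -
  define a b c where "a = x \<bullet> (H *\<^sub>v x)" and "b = x \<bullet> (H *\<^sub>v y)" and "c = y \<bullet> (H *\<^sub>v y)"
  have quad: "0 \<le> s\<^sup>2 * a + 2 * s * t * b + t\<^sup>2 * c" for s t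
  proof -
    let ?z = "s \<cdot>\<^sub>v x + t \<cdot>\<^sub>v y"
    have Hz: "H *\<^sub>v ?z = s \<cdot>\<^sub>v (H *\<^sub>v x) + t \<cdot>\<^sub>v (H *\<^sub>v y)"
      using H x y by (simp add: mult_add_distrib_mat_vec[of _ n n] mult_mat_vec[of _ n n])
    have Hx: "H *\<^sub>v x \<in> carrier_vec n" "H *\<^sub>v y \<in> carrier_vec n" using H x y by auto
    have "?z \<bullet> (H *\<^sub>v ?z) = s\<^sup>2 * a + s * t * b + t * s * (y \<bullet> (H *\<^sub>v x)) + t\<^sup>2 * c"
      unfolding Hz a_def b_def c_def using x y Hx
      by (simp add: add_scalar_prod_distrib[of _ n] scalar_prod_add_distrib[of _ n]
          power2_eq_square algebra_simps)
    also have "\<dots> = s\<^sup>2 * a + 2 * s * t * b + t\<^sup>2 * c"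
      using symmetric_mat_scalar_prod[OF H sym x y] by (simp add: b_def)
    finally show ?thesis using psd[of ?z] x y by simp
  qed
  have "0 \<le> a" "0 \<le> c" using psd x y by (auto simp: a_def c_def)
  have "b\<^sup>2 \<le> a * c"
  proof (cases "a = 0")
    case True
    have "b = 0"
    proof (rule ccontr)
      assume "b \<noteq> 0"
      with quad[of "- (c + 1) / b" 1] True \<open>0 \<le> c\<close> show False by simp
    qed
    then show ?thesis using True by simp
  next
    case False
    then have "0 < a" using \<open>0 \<le> a\<close> by simp
    have "0 \<le> a * (a * c - b\<^sup>2)"
      using quad[of "- b" a] by (simp add: power2_eq_square algebra_simps)
    then show ?thesis using \<open>0 < a\<close> by (simp add: zero_le_mult_iff)
  qed
  then show ?thesis by (simp add: a_def b_def c_def)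
qed

text \<open>The Cauchy-Schwarz inequality for \<open>H\<close> at \<open>x\<close> and \<open>y = H\<^sup>-\<^sup>1 x\<close> reads
  \<open>(x \<bullet> x)\<^sup>2 \<le> (x \<bullet> H x) (x \<bullet> H\<^sup>-\<^sup>1 x)\<close>, and the last factor is at most \<open>K (x \<bullet> x)\<close>. This replaces
  a compactness argument on the unit sphere.\<close>

lemma psd_injective_coercive:
  fixes H :: "real mat"
  assumes H: "H \<in> carrier_mat n n" and sym: "H\<^sup>T = H"
    and psd: "\<And>x. x \<in> carrier_vec n \<Longrightarrow> 0 \<le> x \<bullet> (H *\<^sub>v x)"
    and inj: "\<And>x. x \<in> carrier_vec n \<Longrightarrow> H *\<^sub>v x = 0\<^sub>v n \<Longrightarrow> x = 0\<^sub>v n"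
  obtains \<epsilon> where "0 < \<epsilon>" "\<And>x. x \<in> carrier_vec n \<Longrightarrow> \<epsilon> * (x \<bullet> x) \<le> x \<bullet> (H *\<^sub>v x)"
proof -
  define N where "N = the (mat_inverse H)"
  note N = mat_inverse_of_injective[OF H inj, folded N_def]
  obtain K where K: "0 < K" "\<And>x. x \<in> carrier_vec n \<Longrightarrow> x \<bullet> (N *\<^sub>v x) \<le> K * (x \<bullet> x)"
    using quadratic_form_bounded[OF N(1)] by blast
  show thesis
  proof
    show "0 < 1 / K" using K by simp
    fix x :: "real vec" assume x: "x \<in> carrier_vec n"
    have Nx: "N *\<^sub>v x \<in> carrier_vec n" using N x by simp
    have HN: "H *\<^sub>v (N *\<^sub>v x) = x"
      using assoc_mult_mat_vec[OF H N(1) x] N(2) x by simp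
    have xx: "0 \<le> x \<bullet> x" using vec_norm2_sq[of x] by (metis zero_le_power2)
    have "(x \<bullet> x)\<^sup>2 \<le> (x \<bullet> (H *\<^sub>v x)) * ((N *\<^sub>v x) \<bullet> x)"
      using psd_Cauchy_Schwarz[OF H sym psd x Nx] by (simp add: HN)
    also have "(N *\<^sub>v x) \<bullet> x = x \<bullet> (N *\<^sub>v x)" by (rule comm_scalar_prod[OF Nx x])
    also have "(x \<bullet> (H *\<^sub>v x)) * (x \<bullet> (N *\<^sub>v x)) \<le> (x \<bullet> (H *\<^sub>v x)) * (K * (x \<bullet> x))"
      by (intro mult_left_mono K(2) psd x)
    finally have "(x \<bullet> x) * (x \<bullet> x) \<le> (K * (x \<bullet> (H *\<^sub>v x))) * (x \<bullet> x)"
      by (simp add: power2_eq_square mult_ac)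
    then have "x \<bullet> x \<le> K * (x \<bullet> (H *\<^sub>v x))"
      using xx psd[OF x] K(1) by (cases "x \<bullet> x = 0") auto
    then show "1 / K * (x \<bullet> x) \<le> x \<bullet> (H *\<^sub>v x)"
      using K(1) by (simp add: divide_simps mult_ac)
  qed
qed

text \<open>The infimum \<open>\<mu>\<close> of the Rayleigh quotient is an eigenvalue: \<open>G - \<mu> I\<close> is positive semidefinite,
  and if it were injective, coercivity would allow \<open>\<mu>\<close> to be increased.\<close>

lemma psd_min_eigenvalue:
  fixes G :: "real mat"
  assumes G: "G \<in> carrier_mat n n" and sym: "G\<^sup>T = G" and n: "0 < n"
    and psd: "\<And>x. x \<in> carrier_vec n \<Longrightarrow> 0 \<le> x \<bullet> (G *\<^sub>v x)"
  obtains \<mu> where "eigenvalue G \<mu>" "0 \<le> \<mu>"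
    "\<And>x. x \<in> carrier_vec n \<Longrightarrow> \<mu> * (x \<bullet> x) \<le> x \<bullet> (G *\<^sub>v x)"
proof -
  define R where "R = (\<lambda>x. x \<bullet> (G *\<^sub>v x) / (x \<bullet> x)) ` (carrier_vec n - {0\<^sub>v n})"
  define \<mu> where "\<mu> = Inf R"
  have pos: "0 < x \<bullet> x" if "x \<in> carrier_vec n" "x \<noteq> 0\<^sub>v n" for x :: "real vec"
    using vec_norm2_eq_0_iff[OF that(1)] that(2) vec_norm2_sq[of x]
    by (metis zero_less_power2)
  have "unit_vec n 0 \<in> carrier_vec n - {0\<^sub>v n :: real vec}"
    using n by simp
  then have ne: "R \<noteq> {}" unfolding R_def by blast
  have R0: "0 \<le> r" if "r \<in> R" for r
    using that psd pos unfolding R_def by (auto intro!: divide_nonneg_pos)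
  have bdd: "bdd_below R" using R0 by (rule bdd_belowI)
  have le: "\<mu> * (x \<bullet> x) \<le> x \<bullet> (G *\<^sub>v x)" if x: "x \<in> carrier_vec n" for x
  proof (cases "x = 0\<^sub>v n")
    case True
    then show ?thesis using psd[OF x] by simp
  next
    case False
    have "\<mu> \<le> x \<bullet> (G *\<^sub>v x) / (x \<bullet> x)"
      unfolding \<mu>_def by (rule cInf_lower[OF _ bdd]) (use x False in \<open>auto simp: R_def\<close>)
    then show ?thesis using pos[OF x False] by (simp add: pos_le_divide_eq)
  qed
  define H where "H = G - \<mu> \<cdot>\<^sub>m 1\<^sub>m n"
  have H: "H \<in> carrier_mat n n" unfolding H_def by (intro minus_carrier_mat) simp
  have Hsym: "H\<^sup>T = H"
  proof -
    have "H\<^sup>T = G\<^sup>T - \<mu> \<cdot>\<^sub>m 1\<^sub>m n"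
      unfolding H_def using G by (intro eq_matI) auto
    then show ?thesis by (simp add: sym H_def)
  qed
  have Hv: "H *\<^sub>v x = G *\<^sub>v x - \<mu> \<cdot>\<^sub>v x" if x: "x \<in> carrier_vec n" for x
  proof -
    have "(\<mu> \<cdot>\<^sub>m 1\<^sub>m n) *\<^sub>v x = \<mu> \<cdot>\<^sub>v x"
      using x by (intro eq_vecI) (auto simp: smult_scalar_prod_distrib[of _ n])
    then show ?thesis unfolding H_def
      using minus_mult_distrib_mat_vec[OF G _ x, of "\<mu> \<cdot>\<^sub>m 1\<^sub>m n"] by simp
  qed
  have Hq: "x \<bullet> (H *\<^sub>v x) = x \<bullet> (G *\<^sub>v x) - \<mu> * (x \<bullet> x)" if x: "x \<in> carrier_vec n" for x
    using Hv[OF x] G x by (simp add: scalar_prod_minus_distrib[of _ n])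
  have "\<exists>x. x \<in> carrier_vec n \<and> H *\<^sub>v x = 0\<^sub>v n \<and> x \<noteq> 0\<^sub>v n"
  proof (rule ccontr)
    assume "\<not> ?thesis"
    then have inj: "\<And>x. x \<in> carrier_vec n \<Longrightarrow> H *\<^sub>v x = 0\<^sub>v n \<Longrightarrow> x = 0\<^sub>v n" by blast
    have Hpsd: "\<And>x. x \<in> carrier_vec n \<Longrightarrow> 0 \<le> x \<bullet> (H *\<^sub>v x)" using Hq le by simp
    obtain \<epsilon> where \<epsilon>: "0 < \<epsilon>" "\<And>x. x \<in> carrier_vec n \<Longrightarrow> \<epsilon> * (x \<bullet> x) \<le> x \<bullet> (H *\<^sub>v x)"
      using psd_injective_coercive[OF H Hsym Hpsd inj] by blast
    have "\<mu> + \<epsilon> \<le> Inf R"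
    proof (rule cInf_greatest[OF ne])
      fix r assume "r \<in> R"
      then obtain x where x: "x \<in> carrier_vec n" "x \<noteq> 0\<^sub>v n" and r: "r = x \<bullet> (G *\<^sub>v x) / (x \<bullet> x)"
        unfolding R_def by blast
      have "(\<mu> + \<epsilon>) * (x \<bullet> x) \<le> x \<bullet> (G *\<^sub>v x)"
        using \<epsilon>(2)[OF x(1)] Hq[OF x(1)] by (simp add: distrib_right)
      then show "\<mu> + \<epsilon> \<le> r" unfolding r using pos[OF x] by (simp add: pos_le_divide_eq)
    qed
    then show False using \<epsilon>(1) by (simp add: \<mu>_def)
  qed
  then obtain v where v: "v \<in> carrier_vec n" "v \<noteq> 0\<^sub>v n" and "H *\<^sub>v v = 0\<^sub>v n" by blast
  then have 0: "G *\<^sub>v v - \<mu> \<cdot>\<^sub>v v = 0\<^sub>v n" by (simp add: Hv)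
  have "G *\<^sub>v v = \<mu> \<cdot>\<^sub>v v"
  proof (rule eq_vecI)
    fix i assume "i < dim_vec (\<mu> \<cdot>\<^sub>v v)"
    then have i: "i < n" using v by simp
    have "(G *\<^sub>v v - \<mu> \<cdot>\<^sub>v v) $ i = 0" using 0 i by simp
    then show "(G *\<^sub>v v) $ i = (\<mu> \<cdot>\<^sub>v v) $ i" using i v G by simp
  qed (use G v in simp)
  then have "eigenvalue G \<mu>"
    unfolding eigenvalue_def eigenvector_def using v G by auto
  moreover have "0 \<le> \<mu>" unfolding \<mu>_def by (rule cInf_greatest[OF ne R0])
  ultimately show thesis using le that by blast
qed

lemma gram_scalar_prod:
  fixes V :: "real mat"
  assumes V: "V \<in> carrier_mat m k" and x: "x \<in> carrier_vec k" and y: "y \<in> carrier_vec k"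
  shows "y \<bullet> ((V\<^sup>T * V) *\<^sub>v x) = (V *\<^sub>v y) \<bullet> (V *\<^sub>v x)"
proof -
  have Vx: "V *\<^sub>v x \<in> carrier_vec m" "V *\<^sub>v y \<in> carrier_vec m" using V x y by auto
  have "(V\<^sup>T * V) *\<^sub>v x = V\<^sup>T *\<^sub>v (V *\<^sub>v x)"
    using V x by (simp add: assoc_mult_mat_vec[of _ k m])
  then show ?thesis
    using transpose_vec_mult_scalar[OF V y Vx(1)] V Vx y
    by (metis comm_scalar_prod mult_mat_vec_carrier transpose_carrier_mat)
qed

text \<open>A matrix with at least as many rows as columns has a singular value for every eigenvalue of
  its Gram matrix: the truncation in \<open>singular_values\<close> removes nothing, because the characteristic
  polynomial has at most \<open>k\<close> roots.\<close>

lemma set_singular_values_tall: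
  assumes V: "V \<in> carrier_mat m k" and "k \<le> m"
  shows "set (singular_values V) = sqrt ` {a. eigenvalue (V\<^sup>T * V) a}"
proof -
  let ?p = "char_poly (V\<^sup>T * V)"
  have G: "V\<^sup>T * V \<in> carrier_mat k k" using V by simp
  note deg = degree_monic_char_poly[OF G]
  then have p0: "?p \<noteq> 0" by (metis coeff_0 zero_neq_one)
  let ?l = "sorted_list_of_multiset (image_mset sqrt (proots ?p))"
  have "length ?l = size (proots ?p)"
    by (metis mset_sorted_list_of_multiset size_image_mset size_mset)
  also have "\<dots> \<le> k" using size_proots_le[of ?p] deg by simp
  finally have "singular_values V = rev ?l"
    unfolding singular_values_def using V assms(2) by simp
  then have "set (singular_values V) = sqrt ` {a. poly ?p a = 0}"
    using p0 by simp
  then show ?thesis using eigenvalue_root_char_poly[OF G] by simp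
qed

text \<open>The least eigenvalue of the Gram matrix bounds its Rayleigh quotient \<open>\<parallel>V x\<parallel>\<^sup>2 / \<parallel>x\<parallel>\<^sup>2\<close> from
  below. Positivity is read off at an eigenvector, which \<open>V\<close> does not annihilate.\<close>

lemma sigma_min_lower_bound:
  assumes V: "V \<in> carrier_mat m k" and k: "0 < k" "k \<le> m"
    and inj: "\<And>x. x \<in> carrier_vec k \<Longrightarrow> V *\<^sub>v x = 0\<^sub>v m \<Longrightarrow> x = 0\<^sub>v k"
  shows "0 < sigma_min V"
    and "x \<in> carrier_vec k \<Longrightarrow> sigma_min V * vec_norm2 x \<le> vec_norm2 (V *\<^sub>v x)"
proof -
  define G where "G = V\<^sup>T * V"
  have G: "G \<in> carrier_mat k k" using V by (simp add: G_def)
  have sym: "G\<^sup>T = G"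
    unfolding G_def using V transpose_mult[of "V\<^sup>T" k m V k] by simp
  have Gq: "x \<bullet> (G *\<^sub>v x) = (vec_norm2 (V *\<^sub>v x))\<^sup>2" if "x \<in> carrier_vec k" for x
    unfolding G_def vec_norm2_sq by (rule gram_scalar_prod[OF V that that])
  have psd: "0 \<le> x \<bullet> (G *\<^sub>v x)" if "x \<in> carrier_vec k" for x
    using Gq[OF that] by simp
  obtain \<mu> where \<mu>: "eigenvalue G \<mu>" "0 \<le> \<mu>"
    and le: "\<And>x. x \<in> carrier_vec k \<Longrightarrow> \<mu> * (x \<bullet> x) \<le> x \<bullet> (G *\<^sub>v x)"
    using psd_min_eigenvalue[OF G sym k(1) psd] by blast
  have set_eq: "set (singular_values V) = sqrt ` {a. eigenvalue G a}"
    unfolding G_def by (rule set_singular_values_tall[OF V k(2)])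
  have "sigma_min V \<in> set (singular_values V)"
    unfolding sigma_min_def
  proof (rule Min_in[OF List.finite_set])
    show "set (singular_values V) \<noteq> {}" using \<mu>(1) set_eq by auto
  qed
  then obtain a where a: "sigma_min V = sqrt a" "eigenvalue G a" using set_eq by blast
  obtain v where v: "v \<in> carrier_vec k" "v \<noteq> 0\<^sub>v k" "G *\<^sub>v v = a \<cdot>\<^sub>v v"
    using a(2) G unfolding eigenvalue_def eigenvector_def by auto
  have "a * (vec_norm2 v)\<^sup>2 = v \<bullet> (G *\<^sub>v v)" using v by (simp add: vec_norm2_sq)
  also have "\<dots> = (vec_norm2 (V *\<^sub>v v))\<^sup>2" by (rule Gq[OF v(1)])
  also have "\<dots> > 0"
    using inj[OF v(1)] v(2) vec_norm2_eq_0_iff[OF mult_mat_vec_carrier[OF V v(1)]] by auto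
  finally have "0 < a" by (simp add: zero_less_mult_iff)
  then show "0 < sigma_min V" using a by simp
  assume x: "x \<in> carrier_vec k"
  have "sigma_min V \<le> sqrt \<mu>"
    unfolding sigma_min_def by (intro Min_le List.finite_set) (simp add: set_eq \<mu>(1))
  then have "sigma_min V * vec_norm2 x \<le> sqrt \<mu> * vec_norm2 x"
    by (rule mult_right_mono) simp
  also have "\<dots> = sqrt (\<mu> * (x \<bullet> x))"
    by (simp add: real_sqrt_mult flip: vec_norm2_sq)
  also have "\<dots> \<le> sqrt ((vec_norm2 (V *\<^sub>v x))\<^sup>2)"
    using le[OF x] Gq[OF x] by (intro real_sqrt_le_mono) simp
  finally show "sigma_min V * vec_norm2 x \<le> vec_norm2 (V *\<^sub>v x)" by simp
qed

text \<open>The rank is the dimension of the span of the \<^emph>\<open>set\<close> of columns. Before full rank yields linear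
  independence of the family, it has to exclude repeated columns.\<close>

lemma full_column_rank_injective:
  fixes V :: "real mat"
  assumes V: "V \<in> carrier_mat m k" and rank: "vec_space.rank m V = k"
    and x: "x \<in> carrier_vec k" and Vx: "V *\<^sub>v x = 0\<^sub>v m"
  shows "x = 0\<^sub>v k"
proof (rule ccontr)
  assume x0: "x \<noteq> 0\<^sub>v k"
  interpret vec_space "TYPE(real)" m .
  have "distinct (cols V)"
  proof (rule card_distinct)
    obtain S where S: "maximal S (\<lambda>T. T \<subseteq> set (cols V) \<and> lin_indpt T)"
      using maximal_exists[of "(\<lambda>T. T \<subseteq> set (cols V) \<and> lin_indpt T)" "card (set (cols V))" "{}"]
      by (meson List.finite_set card_mono empty_iff empty_subsetI finite_lin_indpt2 rev_finite_subset)
    then have "card S \<le> card (set (cols V))" by (simp add: card_mono maximal_def)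
    moreover have "card S = k" using rank_card_indpt[OF V S] rank by simp
    ultimately show "card (set (cols V)) = length (cols V)"
      using V card_length[of "cols V"] by simp
  qed
  with full_rank_lin_indpt[OF V rank] lin_depI[OF V x x0 Vx] show False by blast
qed

section \<open>Growth in a recursion with unit coefficients\<close>

text \<open>The Cauchy-Schwarz inequality for \<open>(1, t \<surd>a)\<close> and \<open>(y, s / \<surd>a)\<close>, in a form that also covers
  \<open>a = 0\<close>.\<close>

lemma square_add_scaled_le:
  fixes y s a Y t :: real
  assumes "s\<^sup>2 \<le> a * Y" "0 \<le> a" "0 \<le> Y"
  shows "(y + t * s)\<^sup>2 \<le> (1 + t\<^sup>2 * a) * (y\<^sup>2 + Y)"
proof -
  have "(2 * (y * t * s))\<^sup>2 = 4 * (y * t)\<^sup>2 * s\<^sup>2" by (simp add: power2_eq_square)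
  also have "\<dots> \<le> 4 * (y * t)\<^sup>2 * (a * Y)" by (intro mult_left_mono assms) simp
  also have "\<dots> = (t\<^sup>2 * a * y\<^sup>2 + Y)\<^sup>2 - (t\<^sup>2 * a * y\<^sup>2 - Y)\<^sup>2"
    by (simp add: power2_eq_square algebra_simps)
  also have "\<dots> \<le> (t\<^sup>2 * a * y\<^sup>2 + Y)\<^sup>2" by simp
  finally have "2 * (y * t * s) \<le> t\<^sup>2 * a * y\<^sup>2 + Y"
    by (rule power2_le_imp_le) (use assms in simp)
  moreover have "t\<^sup>2 * s\<^sup>2 \<le> t\<^sup>2 * (a * Y)" by (intro mult_left_mono assms) simp
  ultimately show ?thesis by (simp add: power2_eq_square algebra_simps)
qed

text \<open>This is the Frobenius norm bound for the inverse of a unit lower triangular matrix with entries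
  of modulus at most 1. The partial sums \<open>s\<close> satisfy \<open>s (Suc i) \<le> y i + 2 * s i\<close>, hence
  \<open>s i \<le> \<Sum>\<^bsub>b<i\<^esub> 2\<^bsup>i-1-b\<^esup> y b\<close>, and \<open>a i = \<Sum>\<^bsub>d<i\<^esub> 4\<^sup>d\<close> is the sum of the squares of these
  coefficients. Adding the bounds for all \<open>z i\<close> gives the factor \<open>(4\<^sup>k + 6 k - 1) / 9\<close>, which is at most
  \<open>4\<^sup>k / 3\<close>.\<close>

lemma sum_squares_growth:
  fixes y z :: "nat \<Rightarrow> real"
  assumes z0: "\<And>i. i < k \<Longrightarrow> 0 \<le> z i"
    and rec: "\<And>i. i < k \<Longrightarrow> z i \<le> y i + (\<Sum>b<i. z b)"
  shows "(\<Sum>i<k. (z i)\<^sup>2) \<le> 4 ^ k / 3 * (\<Sum>i<k. (y i)\<^sup>2)"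
proof -
  define a where "a i = (4 ^ i - 1) / (3::real)" for i :: nat
  have a0: "0 \<le> a i" for i by (simp add: a_def)
  define s where "s i = (\<Sum>b<i. z b)" for i
  define Y where "Y i = (\<Sum>b<i. (y b)\<^sup>2)" for i
  have Y0: "0 \<le> Y i" for i by (simp add: Y_def sum_nonneg)
  have s0: "0 \<le> s i" if "i \<le> k" for i
    unfolding s_def using z0 that by (intro sum_nonneg) auto
  have s_sq: "(s i)\<^sup>2 \<le> a i * Y i" if "i \<le> k" for i
    using that
  proof (induction i)
    case 0
    then show ?case by (simp add: s_def a_def)
  next
    case (Suc i)
    have "s (Suc i) \<le> y i + 2 * s i" using rec[of i] Suc.prems by (simp add: s_def)
    then have "(s (Suc i))\<^sup>2 \<le> (y i + 2 * s i)\<^sup>2" using s0[OF Suc.prems] by (rule power_mono)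
    also have "\<dots> \<le> (1 + 2\<^sup>2 * a i) * ((y i)\<^sup>2 + Y i)"
      by (rule square_add_scaled_le) (use Suc a0 Y0 in auto)
    also have "1 + 2\<^sup>2 * a i = a (Suc i)" by (simp add: a_def field_simps)
    finally show ?case by (simp add: Y_def add.commute)
  qed
  have z_sq: "(z i)\<^sup>2 \<le> (4 ^ i + 2) / 3 * Y k" if i: "i < k" for i
  proof -
    have "(z i)\<^sup>2 \<le> (y i + 1 * s i)\<^sup>2"
      using rec[OF i] z0[OF i] by (intro power_mono) (auto simp: s_def)
    also have "\<dots> \<le> (1 + 1\<^sup>2 * a i) * ((y i)\<^sup>2 + Y i)"
      by (rule square_add_scaled_le) (use s_sq[of i] i a0 Y0 in auto)
    also have "1 + 1\<^sup>2 * a i = (4 ^ i + 2) / 3" by (simp add: a_def field_simps)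
    also have "(y i)\<^sup>2 + Y i = Y (Suc i)" by (simp add: Y_def)
    also have "(4 ^ i + 2) / 3 * Y (Suc i) \<le> (4 ^ i + 2) / 3 * Y k"
      unfolding Y_def using i by (intro mult_left_mono sum_mono2) auto
    finally show ?thesis .
  qed
  have geo: "(\<Sum>i<k. (4 ^ i + 2) / 3) = (4 ^ k - 1 + 6 * real k) / 9"
    by (induction k) (simp_all add: field_simps)
  have pow: "6 * real k \<le> 2 * 4 ^ k + 1"
  proof (induction k)
    case (Suc k)
    define X where "X = (4::real) ^ k"
    have "1 \<le> X" by (simp add: X_def)
    moreover have "6 * real k \<le> 2 * X + 1" using Suc by (simp add: X_def)
    ultimately have "6 * real (Suc k) \<le> 2 * (4 * X) + 1" by simp
    then show ?case by (simp add: X_def)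
  qed simp
  have "(\<Sum>i<k. (z i)\<^sup>2) \<le> (\<Sum>i<k. (4 ^ i + 2) / 3 * Y k)"
    by (intro sum_mono z_sq) simp
  also have "\<dots> = (4 ^ k - 1 + 6 * real k) / 9 * Y k"
    unfolding geo[symmetric] by (rule sum_distrib_right[symmetric])
  also have "\<dots> \<le> 4 ^ k / 3 * Y k"
    using pow by (intro mult_right_mono Y0) simp
  finally show ?thesis by (simp add: Y_def)
qed

section \<open>DEIM residuals\<close>

text \<open>Replacing each column by itself minus a combination of its predecessors is multiplication by a
  unit upper triangular matrix, hence does not change the column space.\<close>

lemma residual_combination:
  fixes v r :: "nat \<Rightarrow> nat \<Rightarrow> real"
  assumes r: "\<And>i j. i \<in> I \<Longrightarrow> j < n \<Longrightarrow> r i j = v i j - (\<Sum>b<j. v i b * c j b)"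
  obtains w where "\<And>i. i \<in> I \<Longrightarrow> (\<Sum>b<n. v i b * x b) = (\<Sum>b<n. r i b * w b)"
proof -
  have "\<exists>w. \<forall>i\<in>I. (\<Sum>b<n. v i b * x b) = (\<Sum>b<n. r i b * w b)" using r
  proof (induction n arbitrary: x)
    case 0
    then show ?case by simp
  next
    case (Suc n)
    from Suc.IH[of "\<lambda>b. x b + x n * c n b"] Suc.prems obtain w where
      w: "\<And>i. i \<in> I \<Longrightarrow> (\<Sum>b<n. v i b * (x b + x n * c n b)) = (\<Sum>b<n. r i b * w b)"
      by auto
    have "(\<Sum>b<Suc n. v i b * x b) = (\<Sum>b<Suc n. r i b * (w(n := x n)) b)" if i: "i \<in> I" for i
    proof -
      have "(\<Sum>b<n. r i b * (w(n := x n)) b) = (\<Sum>b<n. r i b * w b)"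
        by (intro sum.cong) auto
      also have "\<dots> = (\<Sum>b<n. v i b * x b) + x n * (\<Sum>b<n. v i b * c n b)"
        unfolding w[OF i, symmetric]
        by (simp add: sum.distrib sum_distrib_left distrib_left mult_ac)
      finally show ?thesis
        using Suc.prems[OF i, of n, OF lessI] by (simp add: right_diff_distrib left_diff_distrib mult_ac)
    qed
    then show ?case by blast
  qed
  with that show thesis by blast
qed

lemma mult_mat_vec_index_sum:
  assumes "B \<in> carrier_mat l n" "x \<in> carrier_vec n" "i < l"
  shows "(B *\<^sub>v x) $ i = (\<Sum>b<n. B $$ (i,b) * x $ b)"
  using assms by (simp add: scalar_prod_def atLeast0LessThan)

text \<open>Injectivity of the block with rows \<open>ps\<close> and the first \<open>j\<close> columns makes the value of
  \<open>mat_inverse\<close> in \<open>deim_residual\<close> a genuine inverse, so that \<open>c\<close> interpolates the \<open>j\<close>-th column at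
  \<open>ps\<close>.\<close>

lemma deim_residual_interpolates:
  assumes V: "V \<in> carrier_mat m k" and j: "j < k" "length ps = j" and ps: "\<And>a. a < j \<Longrightarrow> ps ! a < m"
    and inj: "\<And>x b. \<forall>a<j. (\<Sum>b<j. V $$ (ps ! a, b) * x b) = 0 \<Longrightarrow> b < j \<Longrightarrow> x b = 0"
  obtains c where "\<And>i. i < m \<Longrightarrow> deim_residual V ps $ i = V $$ (i,j) - (\<Sum>b<j. V $$ (i,b) * c b)"
    and "\<And>a. a < j \<Longrightarrow> deim_residual V ps $ (ps ! a) = 0"
proof (cases "j = 0")
  case True
  show thesis
    by (rule that[of "\<lambda>_. 0"]) (use True j V in \<open>auto simp: deim_residual_def\<close>)
next
  case False
  define B where "B = mat j j (\<lambda>(a, b). V $$ (ps ! a, b))"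
  have B: "B \<in> carrier_mat j j" by (simp add: B_def)
  define f where "f = vec j (\<lambda>a. V $$ (ps ! a, j))"
  have f: "f \<in> carrier_vec j" by (simp add: f_def)
  have B_inj: "x = 0\<^sub>v j" if x: "x \<in> carrier_vec j" and Bx: "B *\<^sub>v x = 0\<^sub>v j" for x
  proof -
    have "(\<Sum>b<j. V $$ (ps ! a, b) * x $ b) = 0" if "a < j" for a
    proof -
      have "(\<Sum>b<j. B $$ (a,b) * x $ b) = 0"
        using mult_mat_vec_index_sum[OF B x that] that unfolding Bx by simp
      then show ?thesis using that by (simp add: B_def)
    qed
    then have "\<forall>b<j. x $ b = 0" using inj[of "\<lambda>b. x $ b"] by blast
    then show ?thesis using x by (intro eq_vecI) auto
  qed
  note N = mat_inverse_of_injective[OF B B_inj]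
  define c where "c = the (mat_inverse B) *\<^sub>v f"
  have c: "c \<in> carrier_vec j" using N(1) f by (simp add: c_def)
  have Bc: "B *\<^sub>v c = f"
    unfolding c_def using assoc_mult_mat_vec[OF B N(1) f] N(2) f by simp
  have res: "deim_residual V ps $ i = V $$ (i,j) - (\<Sum>b<j. V $$ (i,b) * c $ b)" if i: "i < m" for i
  proof -
    have "deim_residual V ps = col V j - mat m j (\<lambda>(a, b). V $$ (a, b)) *\<^sub>v c"
      using False j V by (simp add: deim_residual_def Let_def B_def f_def c_def)
    then show ?thesis
      using mult_mat_vec_index_sum[of "mat m j (\<lambda>(a, b). V $$ (a, b))" m j c i] i j V c by simp
  qed
  moreover have "deim_residual V ps $ (ps ! a) = 0" if a: "a < j" for a
    using mult_mat_vec_index_sum[OF B c a] a res[OF ps[OF a]] by (simp add: Bc) (simp add: B_def f_def)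
  ultimately show thesis by (rule that)
qed

lemma is_DEIM_D:
  assumes "is_DEIM V p" "V \<in> carrier_mat m k" "j < k"
  shows "p ! j < m"
    and "i < m \<Longrightarrow> \<bar>deim_residual V (take j p) $ i\<bar> \<le> \<bar>deim_residual V (take j p) $ (p ! j)\<bar>"
proof -
  have "dim_vec (deim_residual V (take j p)) = m"
    using assms(2) by (simp add: deim_residual_def Let_def)
  with assms show "p ! j < m"
    "i < m \<Longrightarrow> \<bar>deim_residual V (take j p) $ i\<bar> \<le> \<bar>deim_residual V (take j p) $ (p ! j)\<bar>"
    by (auto simp: is_DEIM_def max_abs_index_def)
qed

text \<open>For the step from \<open>j\<close> to \<open>Suc j\<close>, the residual is a nontrivial combination of columns, hence not
  zero, and so its largest entry is not zero either. If \<open>x\<close> is in the kernel of the larger block, write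
  the combination of columns as \<open>x j\<close> times the residual plus a combination of the first \<open>j\<close> columns.
  The residual vanishes at the earlier indices, so the induction hypothesis kills the second part;
  evaluation at \<open>p ! j\<close> then forces \<open>x j = 0\<close>.\<close>

lemma deim_leading_block_injective:
  assumes V: "V \<in> carrier_mat m k" and deim: "is_DEIM V p"
    and inj: "\<And>x. x \<in> carrier_vec k \<Longrightarrow> V *\<^sub>v x = 0\<^sub>v m \<Longrightarrow> x = 0\<^sub>v k"
    and "j \<le> k" and "\<forall>a<j. (\<Sum>b<j. V $$ (p ! a, b) * x b) = 0" and "b < j"
  shows "x b = 0"
  using assms(4-6)
proof (induction j arbitrary: x b)
  case (Suc j)
  have j: "j < k" and len: "length p = k" using Suc.prems deim V by (auto simp: is_DEIM_def)
  let ?r = "deim_residual V (take j p)"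
  have p: "p ! a < m" if "a < k" for a using is_DEIM_D(1)[OF deim V that] .
  obtain c where res: "\<And>i. i < m \<Longrightarrow> ?r $ i = V $$ (i,j) - (\<Sum>b<j. V $$ (i,b) * c b)"
    and zero: "\<And>a. a < j \<Longrightarrow> ?r $ (p ! a) = 0"
  proof (rule deim_residual_interpolates[OF V j, of "take j p"])
    show "x b = 0" if "\<forall>a<j. (\<Sum>b<j. V $$ (take j p ! a, b) * x b) = 0" "b < j" for x b
      using Suc.IH[of x b] that j by simp
  qed (use j len p in auto)
  have "?r $ (p ! j) \<noteq> 0"
  proof
    assume "?r $ (p ! j) = 0"
    then have r0: "?r $ i = 0" if "i < m" for i
      using is_DEIM_D(2)[OF deim V j that] by simp
    \<comment> \<open>the coefficients of the residual with respect to the columns of \<open>V\<close>\<close>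
    define u where "u = vec k (\<lambda>b. if b < j then - c b else if b = j then 1 else 0)"
    have u: "u \<in> carrier_vec k" by (simp add: u_def)
    have "(V *\<^sub>v u) $ i = 0" if i: "i < m" for i
    proof -
      have "(V *\<^sub>v u) $ i = (\<Sum>b<k. V $$ (i,b) * u $ b)"
        by (rule mult_mat_vec_index_sum[OF V u i])
      also have "\<dots> = (\<Sum>b<Suc j. V $$ (i,b) * u $ b)"
        using j by (intro sum.mono_neutral_right) (auto simp: u_def)
      also have "\<dots> = V $$ (i,j) - (\<Sum>b<j. V $$ (i,b) * c b)"
        using j by (simp add: u_def sum_negf)
      also have "\<dots> = 0" using res[OF i] r0[OF i] by simp
      finally show ?thesis .
    qed
    then have "V *\<^sub>v u = 0\<^sub>v m" using V by (intro eq_vecI) auto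
    then have "u $ j = 0" using inj[OF u] j by simp
    then show False using j by (simp add: u_def)
  qed
  have split: "(\<Sum>b<Suc j. V $$ (i,b) * x b) = (\<Sum>b<j. V $$ (i,b) * (x b + x j * c b)) + x j * ?r $ i"
    if "i < m" for i
  proof -
    have "(\<Sum>b<j. V $$ (i,b) * (x b + x j * c b))
        = (\<Sum>b<j. V $$ (i,b) * x b) + x j * (\<Sum>b<j. V $$ (i,b) * c b)"
      by (simp add: sum.distrib sum_distrib_left distrib_left mult_ac)
    then show ?thesis by (simp add: res[OF that] right_diff_distrib mult_ac)
  qed
  have kernel: "\<forall>a<j. (\<Sum>b<j. V $$ (p ! a, b) * (x b + x j * c b)) = 0"
  proof (intro allI impI)
    fix a assume a: "a < j"
    have "(\<Sum>b<Suc j. V $$ (p ! a, b) * x b) = 0"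
      using Suc.prems(2) less_SucI[OF a] by blast
    then show "(\<Sum>b<j. V $$ (p ! a, b) * (x b + x j * c b)) = 0"
      using split[OF p, of a] zero[OF a] a j by simp
  qed
  have x: "x b + x j * c b = 0" if "b < j" for b
    by (rule Suc.IH[of "\<lambda>b. x b + x j * c b" b, OF less_imp_le[OF j] kernel that])
  then have "x j * ?r $ (p ! j) = 0"
    using split[of "p ! j"] Suc.prems(2) p[OF j] by simp
  then have "x j = 0" using \<open>?r $ (p ! j) \<noteq> 0\<close> by simp
  with x Suc.prems(3) show ?case by (cases "b = j") auto
qed simp

section \<open>Conditioning of the selected rows\<close>

text \<open>Let \<open>r i b\<close> be entry \<open>i\<close> of the \<open>b\<close>-th residual. Then \<open>r (p ! a) b\<close> is lower triangular in \<open>(a, b)\<close>, and its diagonal entry dominates the whole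
  \<open>b\<close>-th column \<open>r _ b\<close>. Carrying the pivots inside \<open>z\<close> normalises this matrix to unit diagonal without
  dividing by them.\<close>

lemma deim_selected_rows_bound:
  assumes V: "V \<in> carrier_mat m k" and deim: "is_DEIM V p"
    and inj: "\<And>x. x \<in> carrier_vec k \<Longrightarrow> V *\<^sub>v x = 0\<^sub>v m \<Longrightarrow> x = 0\<^sub>v k"
    and x: "x \<in> carrier_vec k"
  shows "(vec_norm2 (V *\<^sub>v x))\<^sup>2
    \<le> real (m * k) / 3 * 4 ^ k * (\<Sum>a<k. (\<Sum>b<k. V $$ (p ! a, b) * x $ b)\<^sup>2)"
proof -
  define r where "r i j = deim_residual V (take j p) $ i" for i j
  have len: "length p = k" using deim V by (simp add: is_DEIM_def)
  have p: "p ! a < m" if "a < k" for a using is_DEIM_D(1)[OF deim V that] .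
  have "\<exists>c. (\<forall>i<m. r i j = V $$ (i,j) - (\<Sum>b<j. V $$ (i,b) * c b)) \<and> (\<forall>a<j. r (p ! a) j = 0)"
    if j: "j < k" for j
  proof (rule deim_residual_interpolates[OF V j, of "take j p"])
    show "y b = 0" if "\<forall>a<j. (\<Sum>b<j. V $$ (take j p ! a, b) * y b) = 0" "b < j" for y b
      using deim_leading_block_injective[OF V deim inj, of j y b] that j by simp
  qed (use j len p in \<open>auto simp: r_def\<close>)
  then obtain c where
    res: "\<And>i j. i < m \<Longrightarrow> j < k \<Longrightarrow> r i j = V $$ (i,j) - (\<Sum>b<j. V $$ (i,b) * c j b)"
    and zero: "\<And>a j. j < k \<Longrightarrow> a < j \<Longrightarrow> r (p ! a) j = 0"
    by metis
  have pivot: "\<bar>r i j\<bar> \<le> \<bar>r (p ! j) j\<bar>" if "i < m" "j < k" for i j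
    unfolding r_def using is_DEIM_D(2)[OF deim V that(2,1)] .
  obtain w where
    w: "\<And>i. i \<in> {..<m} \<Longrightarrow> (\<Sum>b<k. V $$ (i,b) * x $ b) = (\<Sum>b<k. r i b * w b)"
    using residual_combination[of "{..<m}" k r "\<lambda>i b. V $$ (i,b)" c "\<lambda>b. x $ b"] res by auto
  define z where "z b = \<bar>r (p ! b) b * w b\<bar>" for b
  define y where "y a = (\<Sum>b<k. V $$ (p ! a, b) * x $ b)" for a
  have term_le: "\<bar>r i b * w b\<bar> \<le> z b" if "i < m" "b < k" for i b
    unfolding z_def abs_mult using pivot[OF that] by (intro mult_right_mono) auto
  have rec: "z a \<le> \<bar>y a\<bar> + (\<Sum>b<a. z b)" if a: "a < k" for a
  proof -
    have "y a = (\<Sum>b<k. r (p ! a) b * w b)"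
      unfolding y_def using w p[OF a] by simp
    also have "\<dots> = (\<Sum>b<Suc a. r (p ! a) b * w b)"
      using a zero by (intro sum.mono_neutral_right) (auto simp: not_less Suc_le_eq)
    finally have "r (p ! a) a * w a = y a - (\<Sum>b<a. r (p ! a) b * w b)" by simp
    then have "z a \<le> \<bar>y a\<bar> + \<bar>\<Sum>b<a. r (p ! a) b * w b\<bar>" unfolding z_def by linarith
    also have "\<bar>\<Sum>b<a. r (p ! a) b * w b\<bar> \<le> (\<Sum>b<a. \<bar>r (p ! a) b * w b\<bar>)" by (rule sum_abs)
    also have "\<dots> \<le> (\<Sum>b<a. z b)"
      using a p[OF a] by (intro sum_mono term_le) auto
    finally show ?thesis by simp
  qed
  have growth: "(\<Sum>b<k. (z b)\<^sup>2) \<le> 4 ^ k / 3 * (\<Sum>a<k. (y a)\<^sup>2)"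
    using sum_squares_growth[of k z "\<lambda>a. \<bar>y a\<bar>"] rec by (simp add: z_def)
  have entry: "((V *\<^sub>v x) $ i)\<^sup>2 \<le> real k * (\<Sum>b<k. (z b)\<^sup>2)" if i: "i < m" for i
  proof -
    have "\<bar>(V *\<^sub>v x) $ i\<bar> = \<bar>\<Sum>b<k. r i b * w b\<bar>"
      using mult_mat_vec_index_sum[OF V x i] w i by simp
    also have "\<dots> \<le> (\<Sum>b<k. \<bar>r i b * w b\<bar>)" by (rule sum_abs)
    also have "\<dots> \<le> (\<Sum>b<k. z b)" using i by (intro sum_mono term_le) auto
    finally have "((V *\<^sub>v x) $ i)\<^sup>2 \<le> (\<Sum>b<k. z b)\<^sup>2"
      by (metis abs_ge_zero power2_abs power_mono)
    also have "\<dots> \<le> real k * (\<Sum>b<k. (z b)\<^sup>2)"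
    proof -
      have "(\<Sum>b<k. z b) \<le> sqrt (real k) * L2_set z {..<k}"
        using L2_set_mult_ineq[of "\<lambda>_. 1" z "{..<k}"] by (simp add: z_def L2_set_def)
      then have "(\<Sum>b<k. z b)\<^sup>2 \<le> (sqrt (real k) * L2_set z {..<k})\<^sup>2"
        by (rule power_mono) (simp add: z_def sum_nonneg)
      then show ?thesis by (simp add: power_mult_distrib L2_set_def sum_nonneg)
    qed
    finally show ?thesis .
  qed
  have "(vec_norm2 (V *\<^sub>v x))\<^sup>2 = (\<Sum>i<m. ((V *\<^sub>v x) $ i)\<^sup>2)"
    using V x by (simp add: vec_norm2_def L2_set_def sum_nonneg atLeast0LessThan)
  also have "\<dots> \<le> (\<Sum>i<m. real k * (\<Sum>b<k. (z b)\<^sup>2))" by (intro sum_mono entry) simp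
  also have "\<dots> \<le> real (m * k) * (4 ^ k / 3 * (\<Sum>a<k. (y a)\<^sup>2))"
    using mult_left_mono[OF growth, of "real (m * k)"] by (simp add: mult_ac)
  finally show ?thesis by (simp add: y_def mult_ac)
qed

lemma selection_mat_carrier:
  "selection_mat m p \<in> carrier_mat m (length p)"
  by (intro carrier_matI) (simp_all add: selection_mat_def)

lemma transpose_selection_mat_mult:
  assumes V: "V \<in> carrier_mat m k" and p: "\<And>a. a < length p \<Longrightarrow> p ! a < m"
  shows "(selection_mat m p)\<^sup>T * V = mat (length p) k (\<lambda>(a, b). V $$ (p ! a, b))"
proof (rule eq_matI)
  fix a b assume "a < dim_row (mat (length p) k (\<lambda>(a, b). V $$ (p ! a, b)))"
    and "b < dim_col (mat (length p) k (\<lambda>(a, b). V $$ (p ! a, b)))"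
  then have a: "a < length p" and b: "b < k" by auto
  have "col (selection_mat m p) a = unit_vec m (p ! a)"
    using a p[OF a] by (simp add: selection_mat_def)
  then show "((selection_mat m p)\<^sup>T * V) $$ (a,b) = mat (length p) k (\<lambda>(a, b). V $$ (p ! a, b)) $$ (a,b)"
    using a b V p[OF a] selection_mat_carrier[of m p] by simp
qed (use V selection_mat_carrier[of m p] in auto)

lemma deim_selected_rows_inverse:
  assumes V: "V \<in> carrier_mat m k" and k: "0 < k" "k \<le> m"
    and rank: "vec_space.rank m V = k" and deim: "is_DEIM V p"
  defines "B \<equiv> (selection_mat m p)\<^sup>T * V"
  defines "C \<equiv> sqrt (real (m * k) / 3) * (2 ^ k / sigma_min V)"
  shows "invertible_mat B" and "spectral_norm (the (mat_inverse B)) \<le> C"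
    and "invertible_mat (B\<^sup>T)" and "spectral_norm (the (mat_inverse (B\<^sup>T))) \<le> C"
proof -
  have len: "length p = k" using deim V by (simp add: is_DEIM_def)
  have inj: "x = 0\<^sub>v k" if "x \<in> carrier_vec k" "V *\<^sub>v x = 0\<^sub>v m" for x
    using full_column_rank_injective[OF V rank that] .
  have \<sigma>: "0 < sigma_min V"
    "\<And>x. x \<in> carrier_vec k \<Longrightarrow> sigma_min V * vec_norm2 x \<le> vec_norm2 (V *\<^sub>v x)"
    using sigma_min_lower_bound[OF V k] inj by blast+
  have B_eq: "B = mat k k (\<lambda>(a, b). V $$ (p ! a, b))"
    unfolding B_def using transpose_selection_mat_mult[OF V] is_DEIM_D(1)[OF deim V] len by simp
  then have B: "B \<in> carrier_mat k k" by simp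
  have C: "0 \<le> C" unfolding C_def using \<sigma>(1) by simp
  have below: "vec_norm2 x \<le> C * vec_norm2 (B *\<^sub>v x)" if x: "x \<in> carrier_vec k" for x
  proof -
    have "(B *\<^sub>v x) $ a = (\<Sum>b<k. V $$ (p ! a, b) * x $ b)" if "a < k" for a
      using mult_mat_vec_index_sum[OF B x that] that by (simp add: B_eq)
    then have "(vec_norm2 (B *\<^sub>v x))\<^sup>2 = (\<Sum>a<k. (\<Sum>b<k. V $$ (p ! a, b) * x $ b)\<^sup>2)"
      using B by (simp add: vec_norm2_def L2_set_def sum_nonneg atLeast0LessThan)
    then have "(vec_norm2 (V *\<^sub>v x))\<^sup>2 \<le> real (m * k) / 3 * 4 ^ k * (vec_norm2 (B *\<^sub>v x))\<^sup>2"
      using deim_selected_rows_bound[OF V deim inj x] by simp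
    also have "\<dots> = (sqrt (real (m * k) / 3) * 2 ^ k * vec_norm2 (B *\<^sub>v x))\<^sup>2"
    proof -
      have "(2 ^ k)\<^sup>2 = (4::real) ^ k" by (simp add: power2_eq_square flip: power_mult_distrib)
      then show ?thesis by (simp add: power_mult_distrib)
    qed
    finally have "vec_norm2 (V *\<^sub>v x) \<le> sqrt (real (m * k) / 3) * 2 ^ k * vec_norm2 (B *\<^sub>v x)"
      by (rule power2_le_imp_le) simp
    with \<sigma>(2)[OF x]
    have "sigma_min V * vec_norm2 x \<le> sqrt (real (m * k) / 3) * 2 ^ k * vec_norm2 (B *\<^sub>v x)"
      by linarith
    then show ?thesis unfolding C_def using \<sigma>(1) by (simp add: field_simps)
  qed
  show "invertible_mat B" "spectral_norm (the (mat_inverse B)) \<le> C"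
    "invertible_mat (B\<^sup>T)" "spectral_norm (the (mat_inverse (B\<^sup>T))) \<le> C"
    using invertible_if_bounded_below[OF B C below] by simp_all
qed

theorem lemma3p5:
  fixes A V S W :: "real mat" and m n k :: nat and \<theta> \<phi> :: real and p q :: "nat list"
  assumes "A \<in> carrier_mat m n"
    and "1 \<le> k" and "k < min m n"
    and "V \<in> carrier_mat m k" and "S \<in> carrier_mat k k" and "W \<in> carrier_mat n k"
    and "spectral_norm (A - V * S * W\<^sup>T) \<le> \<theta> * singular_value A (k + 1) + \<phi>"
    and "vec_space.rank m V = k" and "vec_space.rank n W = k"
    and "is_DEIM V p" and "is_DEIM W q"
  defines "P \<equiv> selection_mat m p" and "Q \<equiv> selection_mat n q"
  shows "invertible_mat (P\<^sup>T * V) \<and> invertible_mat (W\<^sup>T * Q) \<and>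
    spectral_norm (the (mat_inverse (P\<^sup>T * V))) \<le> sqrt (real (m * k) / 3) * (2 ^ k / sigma_min V) \<and>
    spectral_norm (the (mat_inverse (W\<^sup>T * Q))) \<le> sqrt (real (n * k) / 3) * (2 ^ k / sigma_min W)"
proof -
  have k: "0 < k" "k \<le> m" "k \<le> n" using assms(2,3) by auto
  note rows = deim_selected_rows_inverse[OF assms(4) k(1,2) assms(8,10), folded P_def]
  note cols = deim_selected_rows_inverse[OF assms(6) k(1,3) assms(9,11), folded Q_def]
  have "Q \<in> carrier_mat n k"
    using selection_mat_carrier[of n q] assms(6,11) by (simp add: Q_def is_DEIM_def)
  then have "(Q\<^sup>T * W)\<^sup>T = W\<^sup>T * Q"
    using transpose_mult[of "Q\<^sup>T" k n W k] assms(6) by simp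
  then show ?thesis using rows(1,2) cols(3,4) by simp
qed

end
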